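(* Let $n\ge 1$, let $\gamma: I\to\mathbb{E}^3$ be a unit-speed $(n+2)$-times differentiable regular curve with Frenet frame $\{T,N,B\}$, let $1\le k\le n$, and let $\gamma_k$ be the $k$-principal direction curve of $\gamma$, with principal normal $N_k$ and unit Darboux vector $\overline{W}_k$. If $\gamma$ is an $N_k$-slant helix with axis $\vec u=\sin\theta\,\overline{W}_k+\cos\theta\,N_k$ (a fixed vector, $\theta$ constant), then $\overline{W}_k$ makes a constant angle with the fixed direction $\vec u$; that is, $\gamma$ is a $\overline{W}_k$-Darboux helix.
   Context: $I\subset\mathbb{R}$ is an interval and $\mathbb{E}^3$ is Euclidean 3-space. For a unit-speed curve with nonvanishing second derivative, the Frenet frame is $T=\gamma'$, $N=\gamma''/\|\gamma''\|$, $B=T\times N$. Principal direction curves: let $\gamma_0(s)=\int T(s)\,ds$ be the tangent direction curve of $\gamma$ (a translate of $\gamma$, with frame $T_0=T$, $N_0=N$, $B_0=B$). Recursively for $1\le k\le n$, the $k$-principal direction curve of $\gamma$ is $\gamma_k(s)=\int N_{k-1}(s)\,ds$, where $N_{k-1}$ is the principal normal vector of $\gamma_{k-1}$. It is parametrized by the same arc-length parameter $s$ as $\gamma$ and has Frenet frame $T_k=N_{k-1}$, $N_k=N_{k-1}'/\|N_{k-1}'\|$, $B_k=T_k\times N_k$. It is assumed that $\gamma''\neq 0$ everywhere, so that these frames exist, and that the derivatives appearing in the Frenet equations exist. The curvature $\kappa_k>0$ and torsion $\tau_k$ of $\gamma_k$ are defined by the Frenet equations $T_k'=\kappa_kN_k$,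 $N_k'=-\kappa_kT_k+\tau_kB_k$, $B_k'=-\tau_kN_k$. The Darboux vector of $\gamma_k$ is $W_k=\tau_kT_k+\kappa_kB_k$, and its unit Darboux vector is $\overline{W}_k=W_k/\|W_k\|$. The curve $\gamma$ is an $N_k$-slant helix with axis $\vec u$ if the principal normal vector $N_k$ of $\gamma_k$ makes a constant angle with the fixed direction $\vec u$. The curve $\gamma$ is a $\overline{W}_k$-Darboux helix if $\overline{W}_k$ makes a constant angle with a fixed direction. *)

theory Defs
  imports "HOL-Analysis.Analysis"
begin

type_synonym curve = "real \<Rightarrow> real ^ 3"

text \<open>
  All derivatives are taken relative to the parameter interval \<open>I\<close>, so they are one-sided at end points
  that belong to \<open>I\<close>. They are meaningful only if \<open>I\<close> is nondegenerate.
\<close>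

definition curve_deriv :: "real set \<Rightarrow> curve \<Rightarrow> curve" where
  "curve_deriv I f = (\<lambda>s. vector_derivative f (at s within I))"

definition times_differentiable_on :: "nat \<Rightarrow> curve \<Rightarrow> real set \<Rightarrow> bool" where
  "times_differentiable_on m f I \<longleftrightarrow> (\<forall>j<m. (curve_deriv I ^^ j) f differentiable_on I)"

definition unit_speed_on :: "real set \<Rightarrow> curve \<Rightarrow> bool" where
  "unit_speed_on I f \<longleftrightarrow> f differentiable_on I \<and> (\<forall>s\<in>I. norm (curve_deriv I f s) = 1)"

definition frenet_T :: "real set \<Rightarrow> curve \<Rightarrow> curve" where
  "frenet_T I f = curve_deriv I f"

definition frenet_N :: "real set \<Rightarrow> curve \<Rightarrow> curve" where
  "frenet_N I f = (\<lambda>s. curve_deriv I (curve_deriv I f) s /\<^sub>R norm (curve_deriv I (curve_deriv I f) s))"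

definition frenet_B :: "real set \<Rightarrow> curve \<Rightarrow> curve" where
  "frenet_B I f = (\<lambda>s. cross3 (frenet_T I f s) (frenet_N I f s))"

definition frenet_frame_differentiable_on :: "curve \<Rightarrow> real set \<Rightarrow> bool" where
  "frenet_frame_differentiable_on f I \<longleftrightarrow>
     frenet_T I f differentiable_on I \<and> frenet_N I f differentiable_on I \<and> frenet_B I f differentiable_on I"

definition frenet_equations :: "real set \<Rightarrow> curve \<Rightarrow> real \<Rightarrow> real \<Rightarrow> real \<Rightarrow> bool" where
  "frenet_equations I f s \<kappa> \<tau> \<longleftrightarrow>
     (frenet_T I f has_vector_derivative \<kappa> *\<^sub>R frenet_N I f s) (at s within I) \<and>
     (frenet_N I f has_vector_derivative (- \<kappa>) *\<^sub>R frenet_T I f s + \<tau> *\<^sub>R frenet_B I f s) (at s within I) \<and>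
     (frenet_B I f has_vector_derivative (- \<tau>) *\<^sub>R frenet_N I f s) (at s within I)"

definition curvature :: "real set \<Rightarrow> curve \<Rightarrow> real \<Rightarrow> real" where
  "curvature I f s = (THE \<kappa>. \<kappa> > 0 \<and> (\<exists>\<tau>. frenet_equations I f s \<kappa> \<tau>))"

definition torsion :: "real set \<Rightarrow> curve \<Rightarrow> real \<Rightarrow> real" where
  "torsion I f s = (THE \<tau>. \<exists>\<kappa>>0. frenet_equations I f s \<kappa> \<tau>)"

definition darboux :: "real set \<Rightarrow> curve \<Rightarrow> curve" where
  "darboux I f = (\<lambda>s. torsion I f s *\<^sub>R frenet_T I f s + curvature I f s *\<^sub>R frenet_B I f s)"

definition unit_darboux :: "real set \<Rightarrow> curve \<Rightarrow> curve" where
  "unit_darboux I f = (\<lambda>s. darboux I f s /\<^sub>R norm (darboux I f s))"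

text \<open>
  The curves are indefinite integrals, that is, they are determined up to a translation only;
  hence a relation instead of a function. The frames do not depend on the choice.
\<close>

primrec principal_direction_curve :: "real set \<Rightarrow> curve \<Rightarrow> nat \<Rightarrow> curve \<Rightarrow> bool" where
  "principal_direction_curve I \<gamma> 0 \<beta> \<longleftrightarrow>
     (\<forall>s\<in>I. (\<beta> has_vector_derivative frenet_T I \<gamma> s) (at s within I))"
| "principal_direction_curve I \<gamma> (Suc k) \<beta> \<longleftrightarrow>
     (\<exists>\<alpha>. principal_direction_curve I \<gamma> k \<alpha> \<and>
        (\<forall>s\<in>I. (\<beta> has_vector_derivative frenet_N I \<alpha> s) (at s within I)))"

definition vec_angle :: "real ^ 3 \<Rightarrow> real ^ 3 \<Rightarrow> real" where
  "vec_angle x y = arccos ((x \<bullet> y) / (norm x * norm y))"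

definition constant_angle :: "real set \<Rightarrow> curve \<Rightarrow> real ^ 3 \<Rightarrow> bool" where
  "constant_angle I V u \<longleftrightarrow> u \<noteq> 0 \<and> (\<exists>\<phi>. \<forall>s\<in>I. V s \<noteq> 0 \<and> vec_angle (V s) u = \<phi>)"

definition slant_helix :: "real set \<Rightarrow> curve \<Rightarrow> nat \<Rightarrow> real ^ 3 \<Rightarrow> bool" where
  "slant_helix I \<gamma> k u \<longleftrightarrow>
     (\<exists>\<beta>. principal_direction_curve I \<gamma> k \<beta> \<and> constant_angle I (frenet_N I \<beta>) u)"

definition darboux_helix :: "real set \<Rightarrow> curve \<Rightarrow> nat \<Rightarrow> bool" where
  "darboux_helix I \<gamma> k \<longleftrightarrow>
     (\<exists>\<beta> u. principal_direction_curve I \<gamma> k \<beta> \<and> constant_angle I (unit_darboux I \<beta>) u)"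

end

theory Submission
  imports Defs
begin

text \<open>
  Wherever the Frenet equations of \<open>\<gamma>k\<close> hold with curvature \<open>\<kappa> > 0\<close>, the Darboux vector
  \<open>\<tau> T + \<kappa> B\<close> is nonzero and orthogonal to \<open>N\<close>. Its normalization \<open>W\<close> is therefore a unit vector
  orthogonal to \<open>N\<close>, and \<open>W \<bullet> u = sin \<theta>\<close> follows by taking the inner product of \<open>W\<close> with
  \<open>u = sin \<theta> W + cos \<theta> N\<close>. Since \<open>u\<close> is fixed, the angle between \<open>W\<close> and \<open>u\<close> does not depend on \<open>s\<close>.

  The work lies in showing that the Frenet equations do hold, because curvature and torsion are
  defined by unique description from them. Three points have to be settled.

  \<^item> The slant condition speaks of some \<open>k\<close>-principal direction curve. Such curves are determined
    up to translation, so all of them have the same frame on \<open>I\<close>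
    (\<open>principal_direction_curve_frame_unique\<close>), and the condition provides \<open>N \<noteq> 0\<close> for \<open>\<gamma>k\<close> itself.

  \<^item> The tangent of \<open>\<gamma>k\<close> is the normal of the preceding direction curve, which is a unit vector or,
    where the preceding curvature vanishes, the default value \<open>0\<close>. As \<open>\<gamma>k\<close> has a differentiable
    tangent, the length of the tangent is continuous on the interval \<open>I\<close> and takes only the values
    \<open>0\<close> and \<open>1\<close>, hence is constant; it is not \<open>0\<close>, since then \<open>N\<close> would vanish as well
    (\<open>unit_speed_of_nonvanishing_normal\<close>).

  \<^item> For a curve with unit tangent, the orthonormality of the frame forces the Frenet equations
    (\<open>frenet_equations_of_unit_speed\<close>).
\<close>

section \<open>Derivatives relative to an interval\<close>

lemma interval_at_within_neq_bot:
  fixes I :: "real set"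
  assumes "is_interval I" "interior I \<noteq> {}" "s \<in> I"
  shows "at s within I \<noteq> bot"
proof -
  have "I \<noteq> {x}" for x
    using assms(2) by (metis interior_singleton)
  then have "s islimpt I"
    using assms by (intro connected_imp_perfect) (auto simp: is_interval_connected)
  then show ?thesis
    by (simp add: trivial_limit_within)
qed

lemma curve_deriv_eqI:
  assumes "at s within I \<noteq> bot" "(f has_vector_derivative d) (at s within I)"
  shows "curve_deriv I f s = d"
  using assms by (simp add: curve_deriv_def vector_derivative_within)

lemma has_vector_derivative_curve_deriv:
  assumes "f differentiable_on I" "s \<in> I"
  shows "(f has_vector_derivative curve_deriv I f s) (at s within I)"
  using assms by (simp add: curve_deriv_def differentiable_on_def flip: vector_derivative_works)

lemma curve_deriv_cong:
  assumes "\<And>x. x \<in> I \<Longrightarrow> f x = g x" "s \<in> I"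
  shows "curve_deriv I f s = curve_deriv I g s"
  unfolding curve_deriv_def
  by (rule vector_derivative_cong_eq) (use assms in auto)

lemma inner_constant_imp_derivatives:
  fixes f g :: "real \<Rightarrow> 'a::real_inner"
  assumes "at s within I \<noteq> bot" "s \<in> I"
    and const: "\<And>x. x \<in> I \<Longrightarrow> f x \<bullet> g x = c"
    and f: "(f has_vector_derivative f') (at s within I)"
    and g: "(g has_vector_derivative g') (at s within I)"
  shows "f s \<bullet> g' + f' \<bullet> g s = 0"
proof (rule vector_derivative_unique_within[OF assms(1)])
  show "((\<lambda>x. f x \<bullet> g x) has_vector_derivative f s \<bullet> g' + f' \<bullet> g s) (at s within I)"
    by (rule bounded_bilinear.has_vector_derivative[OF bounded_bilinear_inner f g])
  show "((\<lambda>x. f x \<bullet> g x) has_vector_derivative 0) (at s within I)"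
    by (rule has_vector_derivative_transform[OF assms(2) const has_vector_derivative_const])
qed

section \<open>The frame of a principal direction curve\<close>

lemma frenet_N_cong:
  assumes "\<And>x. x \<in> I \<Longrightarrow> frenet_T I f x = frenet_T I g x" "s \<in> I"
  shows "frenet_N I f s = frenet_N I g s"
  using curve_deriv_cong[of I "curve_deriv I f" "curve_deriv I g" s] assms
  by (simp add: frenet_N_def frenet_T_def)

text \<open>
  Induction on the order: each step prescribes the tangent as the normal of the preceding curve, and
  that normal is computed from the values on \<open>I\<close> of the preceding tangent.
\<close>

lemma principal_direction_curve_frame_unique:
  assumes I: "is_interval I" "interior I \<noteq> {}"
    and "principal_direction_curve I \<gamma> k \<alpha>" "principal_direction_curve I \<gamma> k \<beta>" "s \<in> I"
  shows "frenet_T I \<alpha> s = frenet_T I \<beta> s" "frenet_N I \<alpha> s = frenet_N I \<beta> s"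
proof -
  have tangent: "\<forall>s\<in>I. frenet_T I f s = d s"
    if "\<forall>s\<in>I. (f has_vector_derivative d s) (at s within I)" for f d
    using that curve_deriv_eqI[OF interval_at_within_neq_bot[OF I]] by (auto simp: frenet_T_def)
  have T: "\<forall>s\<in>I. frenet_T I \<alpha> s = frenet_T I \<beta> s"
    using assms(3,4)
  proof (induction k arbitrary: \<alpha> \<beta>)
    case 0
    then show ?case
      using tangent[of \<alpha> "frenet_T I \<gamma>"] tangent[of \<beta> "frenet_T I \<gamma>"] by simp
  next
    case (Suc k)
    from Suc.prems obtain \<alpha>' \<beta>'
      where dirs: "principal_direction_curve I \<gamma> k \<alpha>'" "principal_direction_curve I \<gamma> k \<beta>'"
        and \<alpha>: "\<forall>s\<in>I. (\<alpha> has_vector_derivative frenet_N I \<alpha>' s) (at s within I)"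
        and \<beta>: "\<forall>s\<in>I. (\<beta> has_vector_derivative frenet_N I \<beta>' s) (at s within I)"
      by auto
    have "frenet_N I \<alpha>' s = frenet_N I \<beta>' s" if "s \<in> I" for s
      using Suc.IH[OF dirs] that by (intro frenet_N_cong) auto
    then show ?case
      using tangent[OF \<alpha>] tangent[OF \<beta>] by simp
  qed
  show "frenet_T I \<alpha> s = frenet_T I \<beta> s"
    using T \<open>s \<in> I\<close> by blast
  show "frenet_N I \<alpha> s = frenet_N I \<beta> s"
    using T \<open>s \<in> I\<close> by (intro frenet_N_cong) auto
qed

lemma norm_frenet_N: "norm (frenet_N I f s) = (if frenet_N I f s = 0 then 0 else 1)"
  by (auto simp: frenet_N_def)

lemma norm_frenet_T_principal_direction_curve:
  assumes I: "is_interval I" "interior I \<noteq> {}"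
    and "principal_direction_curve I \<gamma> k \<beta>" "1 \<le> k" "s \<in> I"
  shows "norm (frenet_T I \<beta> s) \<in> {0, 1}"
proof -
  from \<open>1 \<le> k\<close> obtain j where "k = Suc j"
    by (cases k) auto
  with assms(3,5) obtain \<alpha> where "(\<beta> has_vector_derivative frenet_N I \<alpha> s) (at s within I)"
    by auto
  then have "frenet_T I \<beta> s = frenet_N I \<alpha> s"
    using curve_deriv_eqI[OF interval_at_within_neq_bot[OF I \<open>s \<in> I\<close>]] by (simp add: frenet_T_def)
  then show ?thesis
    using norm_frenet_N[of I \<alpha> s] by auto
qed

text \<open>
  A continuous function with finitely many values on an interval is constant, so the tangent has the
  same length everywhere; length \<open>0\<close> would make the normal vanish.
\<close>

lemma unit_speed_of_nonvanishing_normal: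
  assumes I: "is_interval I" "interior I \<noteq> {}"
    and diff: "frenet_T I f differentiable_on I"
    and range: "\<And>s. s \<in> I \<Longrightarrow> norm (frenet_T I f s) \<in> {0, 1}"
    and N: "\<And>s. s \<in> I \<Longrightarrow> frenet_N I f s \<noteq> 0"
    and "s \<in> I"
  shows "norm (frenet_T I f s) = 1"
proof (rule ccontr)
  assume "norm (frenet_T I f s) \<noteq> 1"
  have "(\<lambda>x. norm (frenet_T I f x)) constant_on I"
  proof (rule continuous_finite_range_constant)
    show "connected I"
      using I(1) by (rule is_interval_connected)
    show "continuous_on I (\<lambda>x. norm (frenet_T I f x))"
      by (intro continuous_on_norm differentiable_imp_continuous_on diff)
    show "finite ((\<lambda>x. norm (frenet_T I f x)) ` I)"
      by (rule finite_subset[OF image_subsetI[OF range]]) simp_all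
  qed
  then have "norm (frenet_T I f x) = norm (frenet_T I f s)" if "x \<in> I" for x
    using that \<open>s \<in> I\<close> by (metis constant_on_def)
  with range[OF \<open>s \<in> I\<close>] \<open>norm (frenet_T I f s) \<noteq> 1\<close>
  have zero: "frenet_T I f x = 0" if "x \<in> I" for x
    using that by auto
  have "(curve_deriv I f has_vector_derivative 0) (at s within I)"
    by (rule has_vector_derivative_transform[OF \<open>s \<in> I\<close> _ has_vector_derivative_const[of 0]])
      (use zero in \<open>simp add: frenet_T_def\<close>)
  then have "frenet_N I f s = 0"
    using curve_deriv_eqI[OF interval_at_within_neq_bot[OF I \<open>s \<in> I\<close>]] by (simp add: frenet_N_def)
  with N[OF \<open>s \<in> I\<close>] show False ..
qed

section \<open>Frenet equations\<close>

lemma orthonormal_expansion_cross3: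
  fixes a b v :: "real ^ 3"
  assumes "norm a = 1" "norm b = 1" "a \<bullet> b = 0"
  shows "v = (v \<bullet> a) *\<^sub>R a + (v \<bullet> b) *\<^sub>R b + (v \<bullet> cross3 a b) *\<^sub>R cross3 a b"
proof -
  have ab: "a \<bullet> a = 1" "b \<bullet> b = 1" "b \<bullet> a = 0"
    using assms by (simp_all add: inner_commute norm_eq_1)
  have dual: "cross3 b (cross3 a b) = a" "cross3 a (cross3 a b) = - b"
    using ab assms(3) by (simp_all add: Lagrange)
  \<comment> \<open>Expanding \<open>(a \<times> b) \<times> ((a \<times> b) \<times> v)\<close> in two ways isolates the component of \<open>v\<close> in the plane of \<open>a\<close> and \<open>b\<close>.\<close>
  have plane: "cross3 (cross3 a b) v = (a \<bullet> v) *\<^sub>R b - (b \<bullet> v) *\<^sub>R a"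
    using cross_skew[of "cross3 a b" v] by (simp add: Lagrange inner_commute)
  have "cross3 a b \<bullet> cross3 a b = 1"
    using ab assms(3) by (simp add: dot_cross)
  then have "v = (cross3 a b \<bullet> v) *\<^sub>R cross3 a b - cross3 (cross3 a b) (cross3 (cross3 a b) v)"
    by (simp add: Lagrange)
  moreover have "cross3 (cross3 a b) (cross3 (cross3 a b) v) = - (a \<bullet> v) *\<^sub>R a - (b \<bullet> v) *\<^sub>R b"
    using dual cross_skew[of "cross3 a b" a] cross_skew[of "cross3 a b" b]
    by (simp add: plane Cross3.right_diff_distrib cross_mult_right)
  ultimately have "v = (cross3 a b \<bullet> v) *\<^sub>R cross3 a b - (- (a \<bullet> v) *\<^sub>R a - (b \<bullet> v) *\<^sub>R b)"
    by (rule subst[rotated])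
  also have "\<dots> = (v \<bullet> a) *\<^sub>R a + (v \<bullet> b) *\<^sub>R b + (v \<bullet> cross3 a b) *\<^sub>R cross3 a b"
    by (simp add: inner_commute)
  finally show ?thesis .
qed

text \<open>
  By definition \<open>T' = \<kappa> N\<close> with \<open>\<kappa> = \<parallel>T'\<parallel>\<close>. Differentiating \<open>T \<bullet> T = 1\<close>, \<open>T \<bullet> N = 0\<close> and \<open>N \<bullet> N = 1\<close> gives
  \<open>N \<bullet> T = 0\<close>, \<open>N' \<bullet> T = - \<kappa>\<close> and \<open>N' \<bullet> N = 0\<close>, so \<open>N'\<close> has the required form with \<open>\<tau> = N' \<bullet> B\<close>; the
  equation for \<open>B'\<close> is the product rule for \<open>B = T \<times> N\<close>.
\<close>

lemma frenet_equations_of_unit_speed: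
  assumes at: "\<And>s. s \<in> I \<Longrightarrow> at s within I \<noteq> bot"
    and diff_T: "frenet_T I f differentiable_on I" and diff_N: "frenet_N I f differentiable_on I"
    and unit: "\<And>s. s \<in> I \<Longrightarrow> norm (frenet_T I f s) = 1"
    and N: "\<And>s. s \<in> I \<Longrightarrow> frenet_N I f s \<noteq> 0"
    and "s \<in> I"
  shows "norm (frenet_N I f s) = 1" "frenet_T I f s \<bullet> frenet_N I f s = 0"
    "\<exists>\<kappa>>0. \<exists>\<tau>. frenet_equations I f s \<kappa> \<tau>"
proof -
  define T N where "T = frenet_T I f" and "N = frenet_N I f"
  define \<kappa> where "\<kappa> x = norm (curve_deriv I T x)" for x
  have dT: "(T has_vector_derivative curve_deriv I T x) (at x within I)" if "x \<in> I" for x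
    using has_vector_derivative_curve_deriv[OF diff_T that] by (simp add: T_def)
  have N_eq: "N x = curve_deriv I T x /\<^sub>R \<kappa> x" for x
    by (simp add: N_def T_def frenet_N_def frenet_T_def \<kappa>_def)
  have \<kappa>_pos: "\<kappa> x > 0" if "x \<in> I" for x
    using N[OF that] N_eq[of x] by (auto simp: N_def \<kappa>_def)
  have T'_eq: "curve_deriv I T x = \<kappa> x *\<^sub>R N x" if "x \<in> I" for x
    using \<kappa>_pos[OF that] by (simp add: N_eq)
  have T_T: "T x \<bullet> T x = 1" if "x \<in> I" for x
    using unit[OF that] by (simp add: T_def norm_eq_1)
  have T_N: "T x \<bullet> N x = 0" if "x \<in> I" for x
  proof -
    have "T x \<bullet> curve_deriv I T x + curve_deriv I T x \<bullet> T x = 0"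
      by (rule inner_constant_imp_derivatives[OF at[OF that] that T_T dT[OF that] dT[OF that]])
    then show ?thesis
      by (simp add: inner_commute N_eq)
  qed
  have norm_N: "norm (N x) = 1" if "x \<in> I" for x
    using N[OF that] norm_frenet_N[of I f x] by (simp add: N_def)
  then have N_N: "N x \<bullet> N x = 1" if "x \<in> I" for x
    using that by (simp add: norm_eq_1)
  define N' where "N' = curve_deriv I N s"
  have dN: "(N has_vector_derivative N') (at s within I)"
    using has_vector_derivative_curve_deriv[OF diff_N \<open>s \<in> I\<close>] by (simp add: N_def N'_def)
  have "N s \<bullet> N' + N' \<bullet> N s = 0"
    by (rule inner_constant_imp_derivatives[OF at[OF \<open>s \<in> I\<close>] \<open>s \<in> I\<close> N_N dN dN])
  then have N'_N: "N' \<bullet> N s = 0"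
    by (simp add: inner_commute)
  have "T s \<bullet> N' + curve_deriv I T s \<bullet> N s = 0"
    by (rule inner_constant_imp_derivatives[OF at[OF \<open>s \<in> I\<close>] \<open>s \<in> I\<close> T_N dT[OF \<open>s \<in> I\<close>] dN])
  then have N'_T: "N' \<bullet> T s = - \<kappa> s"
    using N_N[OF \<open>s \<in> I\<close>] by (simp add: T'_eq[OF \<open>s \<in> I\<close>] inner_commute)
  define \<tau> where "\<tau> = N' \<bullet> cross3 (T s) (N s)"
  have N'_eq: "N' = (- \<kappa> s) *\<^sub>R T s + \<tau> *\<^sub>R cross3 (T s) (N s)"
  proof -
    have "norm (T s) = 1"
      using unit[OF \<open>s \<in> I\<close>] by (simp add: T_def)
    then have "N' = (N' \<bullet> T s) *\<^sub>R T s + (N' \<bullet> N s) *\<^sub>R N s + \<tau> *\<^sub>R cross3 (T s) (N s)"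
      unfolding \<tau>_def using norm_N[OF \<open>s \<in> I\<close>] T_N[OF \<open>s \<in> I\<close>] by (rule orthonormal_expansion_cross3)
    then show ?thesis
      unfolding N'_T N'_N by simp
  qed
  have "((\<lambda>x. cross3 (T x) (N x)) has_vector_derivative
          cross3 (T s) N' + cross3 (curve_deriv I T s) (N s)) (at s within I)"
    by (rule bounded_bilinear.has_vector_derivative
        [OF bilinear_cross[unfolded bilinear_conv_bounded_bilinear] dT[OF \<open>s \<in> I\<close>] dN])
  moreover have "cross3 (T s) N' + cross3 (curve_deriv I T s) (N s) = (- \<tau>) *\<^sub>R N s"
    using T_T[OF \<open>s \<in> I\<close>] T_N[OF \<open>s \<in> I\<close>]
    by (simp add: T'_eq[OF \<open>s \<in> I\<close>] N'_eq cross_mult_left cross_mult_right cross_add_right Lagrange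
        Cross3.right_diff_distrib)
  ultimately have "frenet_equations I f s (\<kappa> s) \<tau>"
    using dT[OF \<open>s \<in> I\<close>] dN
    by (simp add: frenet_equations_def frenet_B_def T'_eq[OF \<open>s \<in> I\<close>] N'_eq flip: T_def N_def)
  then show "\<exists>\<kappa>>0. \<exists>\<tau>. frenet_equations I f s \<kappa> \<tau>"
    using \<kappa>_pos[OF \<open>s \<in> I\<close>] by blast
  show "norm (frenet_N I f s) = 1" "frenet_T I f s \<bullet> frenet_N I f s = 0"
    using norm_N[OF \<open>s \<in> I\<close>] T_N[OF \<open>s \<in> I\<close>] by (simp_all add: T_def N_def)
qed

text \<open>
  Positivity is only meaningful once the description defining the curvature is known to have a unique
  solution; the equation \<open>T' = \<kappa> N\<close> with \<open>N \<noteq> 0\<close> determines \<open>\<kappa>\<close>.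
\<close>

lemma curvature_pos:
  assumes at: "at s within I \<noteq> bot" and N: "frenet_N I f s \<noteq> 0"
    and ex: "\<exists>\<kappa>>0. \<exists>\<tau>. frenet_equations I f s \<kappa> \<tau>"
  shows "curvature I f s > 0"
proof -
  from ex obtain \<kappa> \<tau> where \<kappa>: "\<kappa> > 0" "frenet_equations I f s \<kappa> \<tau>"
    by blast
  have "\<kappa>' = \<kappa>" if "frenet_equations I f s \<kappa>' \<tau>'" for \<kappa>' \<tau>'
  proof -
    have "\<kappa>' *\<^sub>R frenet_N I f s = \<kappa> *\<^sub>R frenet_N I f s"
      using that \<kappa>(2) unfolding frenet_equations_def
      by (blast intro: vector_derivative_unique_within[OF at])
    with N show ?thesis
      by simp
  qed
  then have "curvature I f s = \<kappa>"
    unfolding curvature_def using \<kappa> by (intro the_equality) blast+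
  with \<kappa>(1) show ?thesis
    by simp
qed

section \<open>The unit Darboux vector\<close>

text \<open>
  The component of \<open>\<tau> T + \<kappa> B\<close> along the unit vector \<open>B\<close> is \<open>\<kappa> \<noteq> 0\<close>, so the normalization is a genuine one.
\<close>

lemma unit_darboux_orthonormal:
  assumes "norm (frenet_T I f s) = 1" "norm (frenet_N I f s) = 1"
    and T_N: "frenet_T I f s \<bullet> frenet_N I f s = 0"
    and "curvature I f s > 0"
  shows "norm (unit_darboux I f s) = 1" "unit_darboux I f s \<bullet> frenet_N I f s = 0"
proof -
  let ?T = "frenet_T I f s" and ?N = "frenet_N I f s" and ?B = "frenet_B I f s"
  have "?B \<bullet> ?B = 1"
    using assms(1,2) T_N by (simp add: frenet_B_def dot_cross norm_eq_1)
  then have "darboux I f s \<bullet> ?B = curvature I f s"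
    by (simp add: darboux_def inner_add_left frenet_B_def dot_cross_self)
  with assms(4) have "darboux I f s \<noteq> 0"
    by auto
  then show "norm (unit_darboux I f s) = 1"
    by (simp add: unit_darboux_def)
  show "unit_darboux I f s \<bullet> ?N = 0"
    using T_N by (simp add: unit_darboux_def darboux_def inner_add_left frenet_B_def dot_cross_self)
qed

theorem corollary2:
  fixes I :: "real set" and \<gamma> \<gamma>k :: "real \<Rightarrow> real ^ 3" and n k :: nat
    and u :: "real ^ 3" and \<theta> :: real
  assumes "is_interval I" and "interior I \<noteq> {}"
    and "n \<ge> 1" and "1 \<le> k" and "k \<le> n"
    and "times_differentiable_on (n + 2) \<gamma> I"
    and "unit_speed_on I \<gamma>"
    and "\<forall>s\<in>I. curve_deriv I (curve_deriv I \<gamma>) s \<noteq> 0"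
    and "principal_direction_curve I \<gamma> k \<gamma>k"
    and "frenet_frame_differentiable_on \<gamma>k I"
    and "slant_helix I \<gamma> k u"
    and "\<forall>s\<in>I. u = sin \<theta> *\<^sub>R unit_darboux I \<gamma>k s + cos \<theta> *\<^sub>R frenet_N I \<gamma>k s"
  shows "constant_angle I (unit_darboux I \<gamma>k) u \<and> darboux_helix I \<gamma> k"
proof -
  note at = interval_at_within_neq_bot[OF assms(1,2)]
  from assms(11) obtain \<beta>
    where \<beta>: "principal_direction_curve I \<gamma> k \<beta>" "constant_angle I (frenet_N I \<beta>) u"
    by (auto simp: slant_helix_def)
  then have "u \<noteq> 0"
    by (simp add: constant_angle_def)
  have N: "frenet_N I \<gamma>k s \<noteq> 0" if "s \<in> I" for s
    using \<beta>(2) principal_direction_curve_frame_unique(2)[OF assms(1,2,9) \<beta>(1) that] that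
    by (auto simp: constant_angle_def)
  have diff: "frenet_T I \<gamma>k differentiable_on I" "frenet_N I \<gamma>k differentiable_on I"
    using assms(10) by (simp_all add: frenet_frame_differentiable_on_def)
  have unit: "norm (frenet_T I \<gamma>k s) = 1" if "s \<in> I" for s
    by (rule unit_speed_of_nonvanishing_normal[OF assms(1,2) diff(1) _ N that])
      (use norm_frenet_T_principal_direction_curve[OF assms(1,2,9,4)] in auto)
  note frenet = frenet_equations_of_unit_speed[OF at diff unit N]
  have W: "norm (unit_darboux I \<gamma>k s) = 1" "unit_darboux I \<gamma>k s \<bullet> frenet_N I \<gamma>k s = 0" if "s \<in> I" for s
    using unit_darboux_orthonormal[OF unit frenet(1,2) curvature_pos[OF at N frenet(3)]] that
    by blast+
  have "unit_darboux I \<gamma>k s \<noteq> 0 \<and> vec_angle (unit_darboux I \<gamma>k s) u = arccos (sin \<theta> / norm u)"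
    if "s \<in> I" for s
  proof -
    have "u = sin \<theta> *\<^sub>R unit_darboux I \<gamma>k s + cos \<theta> *\<^sub>R frenet_N I \<gamma>k s"
      using assms(12) that by blast
    then have "unit_darboux I \<gamma>k s \<bullet> u =
        unit_darboux I \<gamma>k s \<bullet> (sin \<theta> *\<^sub>R unit_darboux I \<gamma>k s + cos \<theta> *\<^sub>R frenet_N I \<gamma>k s)"
      by (rule arg_cong)
    also have "\<dots> = sin \<theta>"
      using W[OF that] by (simp add: inner_add_right norm_eq_1)
    finally show ?thesis
      using W(1)[OF that] by (auto simp: vec_angle_def)
  qed
  with \<open>u \<noteq> 0\<close> have "constant_angle I (unit_darboux I \<gamma>k) u"
    by (auto simp: constant_angle_def)
  with assms(9) show ?thesis
    by (auto simp: darboux_helix_def)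
qed

end
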